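(* For every real number $c > 1$ there exists $N_0$ such that for every integer $N \geq N_0$ the following holds: if $F$ is a binary image consisting of $N$ ones and having a boundary of length at most $4c\sqrt{N}$, then the largest connected component of $F$ consists of more than $\frac{N}{c^2}-1$ ones.
   Context: A cell is a unit square in $\mathbb{R}^2$ whose vertices have integer coordinates. A binary image is a (finite) rectangle in $\mathbb{R}^2$ made up of cells, in which each cell has been assigned a value $0$ or $1$. A cell with value $1$ is called a one, a cell with value $0$ a zero; the image consists of $N$ ones if exactly $N$ of its cells have value $1$. Two cells are neighbours if they have a common edge. Two ones $c, c'$ are connected if there is a path $c=c_1,\dots,c_n=c'$ of ones with $c_i$ and $c_{i+1}$ neighbours for $1\le i\le n-1$; the equivalence classes of this relation are the connected components of the image. An edge of a cell belongs to the boundary of the image if it is the common edge of two neighbouring cells of the rectangle, one with value $1$ and one with value $0$, or if it belongs to exactly one cell of the rectangle (i.e. lies on the outer edge of the rectangle) and that cell has value $1$. The length of the boundary is the number of edges belonging to the boundary. *)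

theory Defs
  imports Complex_Main
begin

(* The cell [x, x+1] \<times> [y, y+1] is represented by its lower left corner (x, y),
   and a unit lattice segment by the set of its two endpoints. *)

type_synonym point = "int \<times> int"
type_synonym cell = "int \<times> int"
type_synonym edge = "point set"

fun edges :: "cell \<Rightarrow> edge set" where
  "edges (x, y) =
     {{(x, y), (x + 1, y)}, {(x, y + 1), (x + 1, y + 1)},
      {(x, y), (x, y + 1)}, {(x + 1, y), (x + 1, y + 1)}}"

definition neighbours :: "cell \<Rightarrow> cell \<Rightarrow> bool" where
  "neighbours c d \<longleftrightarrow> c \<noteq> d \<and> edges c \<inter> edges d \<noteq> {}"

definition rectangle :: "cell set \<Rightarrow> bool" where
  "rectangle R \<longleftrightarrow> (\<exists>a b a' b'. a < b \<and> a' < b' \<and> R = {a..<b} \<times> {a'..<b'})"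

(* Only the values of v on R are part of the image. *)
definition binary_image :: "cell set \<Rightarrow> (cell \<Rightarrow> nat) \<Rightarrow> bool" where
  "binary_image R v \<longleftrightarrow> rectangle R \<and> (\<forall>c\<in>R. v c \<in> {0, 1})"

definition ones :: "cell set \<Rightarrow> (cell \<Rightarrow> nat) \<Rightarrow> cell set" where
  "ones R v = {c \<in> R. v c = 1}"

definition connected_ones :: "cell set \<Rightarrow> (cell \<Rightarrow> nat) \<Rightarrow> (cell \<times> cell) set" where
  "connected_ones R v =
     {(c, c'). \<exists>p. p \<noteq> [] \<and> hd p = c \<and> last p = c' \<and> set p \<subseteq> ones R v \<and>
        (\<forall>i. Suc i < length p \<longrightarrow> neighbours (p ! i) (p ! Suc i))}"

definition components :: "cell set \<Rightarrow> (cell \<Rightarrow> nat) \<Rightarrow> cell set set" where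
  "components R v = ones R v // connected_ones R v"

definition boundary :: "cell set \<Rightarrow> (cell \<Rightarrow> nat) \<Rightarrow> edge set" where
  "boundary R v =
     {e. \<exists>c\<in>R. \<exists>d\<in>R. neighbours c d \<and> e \<in> edges c \<inter> edges d \<and> v c = 1 \<and> v d = 0} \<union>
     {e. \<exists>c. {d \<in> R. e \<in> edges d} = {c} \<and> v c = 1}"

end

(* Every boundary edge belongs to exactly one cell of value one, so the perimeters of the components
   sum to at most the length of the boundary. If a component of n cells meets a columns and b rows,
   then n is at most a * b, and each of these columns and rows contributes two boundary edges, so
   its perimeter is at least 2 (a + b), hence at least 4 sqrt n. If M is the largest n then sqrt n
   is at least n / sqrt M, and summation gives the lower bound 4 N / sqrt M for the boundary, i.e.
   M is at least N / c^2, for every positive N. *)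

theory Submission
  imports Defs
begin

section \<open>Incidence of cells with horizontal and vertical lattice edges\<close>

definition hedge :: "point \<Rightarrow> edge" where
  "hedge = (\<lambda>(x, y). {(x, y), (x + 1, y)})"

(* The arguments are swapped so that rows can be treated as columns of the transposed set. *)
definition vedge :: "point \<Rightarrow> edge" where
  "vedge = (\<lambda>(y, x). {(x, y), (x, y + 1)})"

lemma inj_hedge: "inj hedge"
  by (auto simp: inj_def hedge_def doubleton_eq_iff)

lemma inj_vedge: "inj vedge"
  by (auto simp: inj_def vedge_def doubleton_eq_iff)

lemma hedge_neq_vedge: "hedge p \<noteq> vedge q"
  by (cases p; cases q) (auto simp: hedge_def vedge_def doubleton_eq_iff)

lemma edges_eq:
  "edges (x, y) = {hedge (x, y), hedge (x, y + 1), vedge (y, x), vedge (y, x + 1)}"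
  by (simp add: hedge_def vedge_def)

text \<open>In the unbounded grid an edge lies on precisely two cells, one on either side. Written
  as an equivalence, this has the shape of the last premise of \<open>boundaryI\<close>.\<close>

lemma hedge_in_edges_iff: "hedge (x, y) \<in> edges d \<longleftrightarrow> d = (x, y) \<or> d = (x, y - 1)"
  by (cases d) (auto simp: edges_eq inj_eq[OF inj_hedge] hedge_neq_vedge simp del: edges.simps)

lemma vedge_in_edges_iff: "vedge (y, x) \<in> edges d \<longleftrightarrow> d = (x, y) \<or> d = (x - 1, y)"
  by (cases d)
    (auto simp: edges_eq inj_eq[OF inj_vedge] hedge_neq_vedge[symmetric] simp del: edges.simps)

section \<open>Perimeter of a finite set of cells\<close>

text \<open>Each occupied column supplies the edge above its highest cell and the edge below its
  lowest cell. Keeping \<open>h\<close> abstract lets rows be treated by the same argument, and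
  intersecting with \<open>range h\<close> keeps horizontal and vertical edges apart, so that the
  two counts can be added.\<close>

lemma card_columns_le:
  fixes C :: "(int \<times> int) set" and h :: "int \<times> int \<Rightarrow> 'e"
  assumes "finite C" "finite E" "inj h"
    and up: "\<And>x y. (x, y) \<in> C \<Longrightarrow> (x, y + 1) \<notin> C \<Longrightarrow> h (x, y + 1) \<in> E"
    and down: "\<And>x y. (x, y) \<in> C \<Longrightarrow> (x, y - 1) \<notin> C \<Longrightarrow> h (x, y) \<in> E"
  shows "2 * card (fst ` C) \<le> card (E \<inter> range h)"
proof -
  define col where "col x = {y. (x, y) \<in> C}" for x
  have fin: "finite (col x)" for x
    by (rule finite_subset[of _ "snd ` C"]) (use \<open>finite C\<close> in \<open>force simp: col_def\<close>)+
  have ne: "col x \<noteq> {}" if "x \<in> fst ` C" for x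
    using that by (auto simp: col_def)
  have top: "(x, Max (col x)) \<in> C" "(x, Max (col x) + 1) \<notin> C" if "x \<in> fst ` C" for x
    using Max_in[OF fin ne[OF that]] Max_ge[OF fin, of "Max (col x) + 1" x]
    by (auto simp: col_def)
  have bot: "(x, Min (col x)) \<in> C" "(x, Min (col x) - 1) \<notin> C" if "x \<in> fst ` C" for x
    using Min_in[OF fin ne[OF that]] Min_le[OF fin, of "Min (col x) - 1" x]
    by (auto simp: col_def)
  have le: "Min (col x) \<le> Max (col x)" if "x \<in> fst ` C" for x
    using fin ne[OF that] by simp
  let ?t = "\<lambda>x. h (x, Max (col x) + 1)" and ?b = "\<lambda>x. h (x, Min (col x))"
  have "card (?t ` fst ` C) = card (fst ` C)" "card (?b ` fst ` C) = card (fst ` C)"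
    using \<open>inj h\<close> by (intro card_image inj_onI; simp add: inj_eq)+
  \<comment> \<open>By injectivity, a common edge would come from a single column with Max + 1 =
    Min, which contradicts Min \<le> Max.\<close>
  moreover have "?t ` fst ` C \<inter> ?b ` fst ` C = {}"
    using le \<open>inj h\<close> by (fastforce simp: inj_eq)
  ultimately have "2 * card (fst ` C) = card (?t ` fst ` C \<union> ?b ` fst ` C)"
    using \<open>finite C\<close> by (simp add: card_Un_disjoint)
  also have "\<dots> \<le> card (E \<inter> range h)"
    using \<open>finite E\<close> up[OF top] down[OF bot] by (intro card_mono) blast+
  finally show ?thesis .
qed

text \<open>\<open>E\<close> need only contain the edges across which one leaves \<open>C\<close>,
  so it can later be a set of boundary edges of the image.\<close>

lemma four_sqrt_card_le:
  assumes "finite C" "finite E"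
    and "\<And>x y. (x, y) \<in> C \<Longrightarrow> (x, y + 1) \<notin> C \<Longrightarrow> hedge (x, y + 1) \<in> E"
    and "\<And>x y. (x, y) \<in> C \<Longrightarrow> (x, y - 1) \<notin> C \<Longrightarrow> hedge (x, y) \<in> E"
    and "\<And>x y. (x, y) \<in> C \<Longrightarrow> (x + 1, y) \<notin> C \<Longrightarrow> vedge (y, x + 1) \<in> E"
    and "\<And>x y. (x, y) \<in> C \<Longrightarrow> (x - 1, y) \<notin> C \<Longrightarrow> vedge (y, x) \<in> E"
  shows "4 * sqrt (card C) \<le> card E"
proof -
  let ?a = "card (fst ` C)" and ?b = "card (snd ` C)"
  have "2 * ?a \<le> card (E \<inter> range hedge)"
    by (rule card_columns_le) (use assms inj_hedge in auto)
  \<comment> \<open>The rows of \<open>C\<close> are the columns of its transpose, and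
    \<open>vedge\<close> takes its arguments in transposed order.\<close>
  moreover have "2 * card (fst ` prod.swap ` C) \<le> card (E \<inter> range vedge)"
    by (rule card_columns_le) (use assms inj_vedge in auto)
  moreover have "fst ` prod.swap ` C = snd ` C"
    by force
  moreover have "card (E \<inter> range hedge) + card (E \<inter> range vedge) \<le> card E"
    using \<open>finite E\<close>
    by (subst card_Un_disjoint[symmetric]) (auto simp: hedge_neq_vedge intro: card_mono)
  ultimately have perimeter: "2 * (?a + ?b) \<le> card E"
    by simp
  \<comment> \<open>\<open>C\<close> lies in the product of its two projections; the inequality of
    arithmetic and geometric means then compares area with perimeter.\<close>
  have "card C \<le> card (fst ` C \<times> snd ` C)"
    using \<open>finite C\<close> by (intro card_mono) force+
  then have "real (card C) \<le> real ?a * real ?b"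
    by (metis card_cartesian_product of_nat_le_iff of_nat_mult)
  then have "sqrt (card C) \<le> sqrt (real ?a * real ?b)"
    by simp
  also have "\<dots> \<le> (real ?a + real ?b) / 2"
    by (rule arith_geo_mean_sqrt) auto
  finally show ?thesis
    using of_nat_mono[OF perimeter, where 'a = real] by simp
qed

section \<open>Connectedness as an equivalence relation\<close>

lemma finite_edges: "finite (edges c)"
  by (cases c) simp

lemma neighbours_sym: "neighbours c d \<longleftrightarrow> neighbours d c"
  by (auto simp: neighbours_def)

text \<open>With \<open>successively\<close> in place of indices, paths can be reversed and
  concatenated by simplification.\<close>

lemma connected_ones_successively:
  "(c, c') \<in> connected_ones R v \<longleftrightarrow>
     (\<exists>p. p \<noteq> [] \<and> hd p = c \<and> last p = c' \<and> set p \<subseteq> ones R v \<and> successively neighbours p)"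
  unfolding connected_ones_def successively_conv_nth by auto

lemma equiv_connected_ones: "equiv (ones R v) (connected_ones R v)"
proof (rule equivI)
  show "connected_ones R v \<subseteq> ones R v \<times> ones R v"
    unfolding connected_ones_successively subset_iff split_paired_All mem_Sigma_iff
    by (metis hd_in_set last_in_set)
  show "refl_on (ones R v) (connected_ones R v)"
    by (intro refl_onI) (auto simp: connected_ones_successively intro!: exI[of _ "[_]"])
  show "sym (connected_ones R v)"
  proof (rule symI)
    fix a b assume "(a, b) \<in> connected_ones R v"
    then obtain p where "p \<noteq> []" "hd p = a" "last p = b" "set p \<subseteq> ones R v"
      "successively neighbours p"
      by (auto simp: connected_ones_successively)
    then show "(b, a) \<in> connected_ones R v"
      unfolding connected_ones_successively
      by (intro exI[of _ "rev p"]) (auto simp: hd_rev last_rev neighbours_sym)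
  qed
  show "trans (connected_ones R v)"
  proof (rule transI)
    fix a b d assume "(a, b) \<in> connected_ones R v" "(b, d) \<in> connected_ones R v"
    then obtain p q where pq:
      "p \<noteq> []" "hd p = a" "last p = b" "set p \<subseteq> ones R v" "successively neighbours p"
      "q \<noteq> []" "hd q = b" "last q = d" "set q \<subseteq> ones R v" "successively neighbours q"
      unfolding connected_ones_successively by blast
    \<comment> \<open>The cell \<open>b\<close> ends \<open>p\<close> and begins \<open>q\<close>;
      it must occur only once in the joined path, as no cell is its own neighbour.\<close>
    obtain q' where "q = b # q'"
      using pq by (cases q) auto
    with pq show "(a, d) \<in> connected_ones R v"
      unfolding connected_ones_successively
      by (intro exI[of _ "p @ q'"])
        (cases q'; auto simp: successively_append_iff)
  qed
qed

lemma neighbours_connected: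
  assumes "neighbours c d" "c \<in> ones R v" "d \<in> ones R v"
  shows "(c, d) \<in> connected_ones R v"
  unfolding connected_ones_successively using assms by (intro exI[of _ "[c, d]"]) simp

section \<open>Boundary edges and the perimeters of the components\<close>

text \<open>The two clauses of \<open>boundary\<close> match the two ways in which \<open>d\<close>
  can fail to be a one: it is a zero of the image, or it lies outside the rectangle and
  \<open>c\<close> is the only cell of the image at \<open>e\<close>.\<close>

lemma boundaryI:
  assumes img: "binary_image R v" and c: "c \<in> ones R v" and "d \<notin> ones R v"
    and cd: "\<And>c'. e \<in> edges c' \<longleftrightarrow> c' = c \<or> c' = d"
  shows "e \<in> boundary R v"
proof (cases "d \<in> R")
  case True
  then have "v d = 0" "v c = 1" "c \<in> R" "c \<noteq> d"
    using assms by (auto simp: binary_image_def ones_def)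
  moreover have "e \<in> edges c \<inter> edges d"
    using cd by auto
  ultimately show ?thesis
    using True unfolding boundary_def neighbours_def by blast
next
  case False
  then have "{d' \<in> R. e \<in> edges d'} = {c}"
    using c cd by (auto simp: ones_def)
  moreover have "v c = 1"
    using c by (simp add: ones_def)
  ultimately show ?thesis
    unfolding boundary_def by blast
qed

lemma finite_boundary:
  assumes "finite R"
  shows "finite (boundary R v)"
proof (rule finite_subset)
  show "boundary R v \<subseteq> (\<Union>c\<in>R. edges c)"
    unfolding boundary_def by blast
qed (use assms finite_edges in auto)

lemma sum_sqrt_components_le:
  assumes img: "binary_image R v"
  shows "(\<Sum>C\<in>components R v. 4 * sqrt (card C)) \<le> card (boundary R v)"
proof -
  have finR: "finite R"
    using img by (auto simp: binary_image_def rectangle_def)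
  then have fin1: "finite (ones R v)"
    by (simp add: ones_def)
  note eq = equiv_connected_ones[of R v]
  have sub: "C \<subseteq> ones R v" if "C \<in> components R v" for C
    using that in_quotient_imp_subset[OF eq] by (simp add: components_def)
  have finK: "finite (components R v)"
    unfolding components_def using finite_quotient eq fin1
    by (metis equiv_type)
  \<comment> \<open>Maximality: a component absorbs every one adjacent to it. This yields both that
    its outer edges are boundary edges and that distinct components share none.\<close>
  have step: "d \<in> C" if "C \<in> components R v" "c \<in> C" "d \<in> ones R v" "neighbours c d" for C c d
    using that sub[OF that(1)] neighbours_connected[of c d R v] in_quotient_imp_closed[OF eq]
    unfolding components_def by blast
  define B where "B C = {e \<in> boundary R v. \<exists>c\<in>C. e \<in> edges c}" for C
  have finB: "finite (B C)" for C
    using finite_boundary[OF finR] by (simp add: B_def)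
  have inB: "e \<in> B C"
    if "C \<in> components R v" "c \<in> C" "d \<notin> C" "\<And>c'. e \<in> edges c' \<longleftrightarrow> c' = c \<or> c' = d" for C c d e
  proof -
    have "neighbours c d"
      using that unfolding neighbours_def by blast
    then have "d \<notin> ones R v"
      using step that by blast
    then have "e \<in> boundary R v"
      using boundaryI[OF img] sub[OF that(1)] that by blast
    then show ?thesis
      using that unfolding B_def by blast
  qed
  have "4 * sqrt (card C) \<le> card (B C)" if C: "C \<in> components R v" for C
  proof (rule four_sqrt_card_le)
    show "finite C"
      using finite_subset[OF sub[OF C] fin1] .
    show "finite (B C)"
      by (rule finB)
    fix x y assume xy: "(x, y) \<in> C"
    show "hedge (x, y + 1) \<in> B C" if "(x, y + 1) \<notin> C"
      by (rule inB[OF C xy that]) (auto simp: hedge_in_edges_iff)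
    show "hedge (x, y) \<in> B C" if "(x, y - 1) \<notin> C"
      by (rule inB[OF C xy that]) (auto simp: hedge_in_edges_iff)
    show "vedge (y, x + 1) \<in> B C" if "(x + 1, y) \<notin> C"
      by (rule inB[OF C xy that]) (auto simp: vedge_in_edges_iff)
    show "vedge (y, x) \<in> B C" if "(x - 1, y) \<notin> C"
      by (rule inB[OF C xy that]) (auto simp: vedge_in_edges_iff)
  qed
  then have "(\<Sum>C\<in>components R v. 4 * sqrt (card C)) \<le> (\<Sum>C\<in>components R v. real (card (B C)))"
    by (rule sum_mono)
  also have "\<dots> = card (\<Union>C\<in>components R v. B C)"
  proof -
    \<comment> \<open>An edge common to both sets would make a cell of \<open>C\<close> and a cell
      of \<open>D\<close> neighbours, so the two components would coincide.\<close>
    have "B C \<inter> B D = {}" if "C \<in> components R v" "D \<in> components R v" "C \<noteq> D" for C D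
    proof -
      have disj: "C \<inter> D = {}"
        using quotient_disj[OF eq] that unfolding components_def by blast
      show ?thesis
      proof (rule ccontr)
        assume "B C \<inter> B D \<noteq> {}"
        then obtain e c d where "e \<in> edges c" "e \<in> edges d" and c: "c \<in> C" and d: "d \<in> D"
          unfolding B_def by blast
        then have "neighbours c d"
          using disj unfolding neighbours_def by blast
        then show False
          using step[OF that(1) c] sub[OF that(2)] d disj by blast
      qed
    qed
    then show ?thesis
      using finK finB by (subst card_UN_disjoint) auto
  qed
  also have "\<dots> \<le> card (boundary R v)"
    using finite_boundary[OF finR] by (auto simp: B_def intro!: card_mono)
  finally show ?thesis .
qed

section \<open>Size of the largest component\<close>

lemma sum_card_components:
  assumes "finite (ones R v)"
  shows "(\<Sum>C\<in>components R v. card C) = card (ones R v)"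
proof -
  note eq = equiv_connected_ones[of R v]
  have "card (\<Union>(components R v)) = (\<Sum>C\<in>components R v. card C)"
    unfolding components_def
  proof (rule card_Union_disjoint)
    show "pairwise disjnt (ones R v // connected_ones R v)"
      using quotient_disj[OF eq] by (auto simp: pairwise_def disjnt_def)
    show "finite C" if "C \<in> ones R v // connected_ones R v" for C
      using that in_quotient_imp_subset[OF eq] finite_subset assms by blast
  qed
  then show ?thesis
    using Union_quotient[OF eq] by (simp add: components_def)
qed

lemma card_ones_le_Max_component:
  assumes img: "binary_image R v" and "ones R v \<noteq> {}" and "c > 0"
    and bound: "real (card (boundary R v)) \<le> 4 * c * sqrt (card (ones R v))"
  shows "real (card (ones R v)) \<le> c\<^sup>2 * real (Max (card ` components R v))"
proof -
  let ?N = "real (card (ones R v))" and ?M = "Max (card ` components R v)"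
  have fin1: "finite (ones R v)"
    using img by (auto simp: binary_image_def rectangle_def ones_def)
  have finK: "finite (components R v)"
    unfolding components_def using finite_quotient equiv_connected_ones fin1
    by (metis equiv_type)
  have "?N > 0"
    using fin1 \<open>ones R v \<noteq> {}\<close> by (simp add: card_gt_0_iff)
  have "4 * ?N = (\<Sum>C\<in>components R v. 4 * real (card C))"
    using sum_card_components[OF fin1] by (simp flip: sum_distrib_left of_nat_sum)
  also have "\<dots> \<le> (\<Sum>C\<in>components R v. sqrt ?M * (4 * sqrt (card C)))"
  proof (rule sum_mono)
    fix C assume "C \<in> components R v"
    then have "card C \<le> ?M"
      using finK by simp
    \<comment> \<open>Only one of the two equal factors is enlarged to \<open>sqrt ?M\<close>; the
      other is kept for the perimeter bound.\<close>
    then have "sqrt (card C) * sqrt (card C) \<le> sqrt ?M * sqrt (card C)"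
      by (intro mult_right_mono) auto
    then show "4 * real (card C) \<le> sqrt ?M * (4 * sqrt (card C))"
      by simp
  qed
  also have "\<dots> \<le> sqrt ?M * card (boundary R v)"
    using sum_sqrt_components_le[OF img]
    by (simp flip: sum_distrib_left add: mult_left_mono)
  also have "\<dots> \<le> sqrt ?M * (4 * c * sqrt ?N)"
    using bound by (intro mult_left_mono) auto
  finally have "sqrt ?N * sqrt ?N \<le> (c * sqrt ?M) * sqrt ?N"
    by (simp add: mult_ac)
  then have "sqrt ?N \<le> c * sqrt ?M"
    using \<open>?N > 0\<close> by (simp only: mult_le_cancel_right) simp
  then have "(sqrt ?N)\<^sup>2 \<le> (c * sqrt ?M)\<^sup>2"
    by (intro power_mono) auto
  then show ?thesis
    by (simp add: power_mult_distrib)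
qed

theorem theorem3:
  fixes c :: real
  assumes "c > 1"
  shows "\<exists>N\<^sub>0::nat. \<forall>N\<ge>N\<^sub>0. \<forall>R v.
           binary_image R v \<longrightarrow> card (ones R v) = N \<longrightarrow>
           real (card (boundary R v)) \<le> 4 * c * sqrt (real N) \<longrightarrow>
           real (Max (card ` components R v)) > real N / c\<^sup>2 - 1"
\<comment> \<open>The witness 1 guarantees at least one cell of value one, so \<open>Max\<close>
  ranges over a nonempty set and \<open>sqrt N\<close> can be cancelled.\<close>
proof (intro exI[of _ "1::nat"] allI impI)
  fix N R v
  assume "1 \<le> N" "binary_image R v" and N: "card (ones R v) = N"
    and "real (card (boundary R v)) \<le> 4 * c * sqrt (real N)"
  then have "real N \<le> c\<^sup>2 * real (Max (card ` components R v))"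
    using card_ones_le_Max_component[of R v c] \<open>c > 1\<close> by force
  then have "real N / c\<^sup>2 \<le> real (Max (card ` components R v))"
    using \<open>c > 1\<close> by (simp add: divide_le_eq mult.commute)
  then show "real (Max (card ` components R v)) > real N / c\<^sup>2 - 1"
    by linarith
qed

end
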